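(* Let $X$ be a topological space (no separation axioms are assumed). If Two has a winning strategy in the Rothberger game on $X$, then $X_\delta$ is a Lindelöf space.
   Context: The Rothberger game on a topological space $X$ is played by One and Two as follows: in each inning $n\in\omega$, One chooses an open cover $\mathcal U_n$ of $X$, and then Two chooses $U_n\in\mathcal U_n$. Two wins the play if $X=\bigcup_{n\in\omega}U_n$; otherwise One wins. A winning strategy for Two is a function assigning to each finite nonempty sequence $(\mathcal U_0,\dots,\mathcal U_n)$ of moves of One a legal answer $U_n$ of Two such that Two wins every play in which her moves are given by this function. $X_\delta$ denotes the set $X$ endowed with the topology generated by the $G_\delta$ subsets of the original topology of $X$. A space is Lindelöf if every open cover has a countable subcover (no separation axiom is included). *)

theory Defs
  imports "HOL-Analysis.Analysis"
begin

definition open_cover :: "'a topology \<Rightarrow> 'a set set \<Rightarrow> bool" where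
  "open_cover X \<U> \<longleftrightarrow> (\<forall>U\<in>\<U>. openin X U) \<and> \<Union>\<U> = topspace X"

(* A strategy answers the list [U_0, ..., U_n] of One's moves so far with Two's move in inning n;
   its values at the empty list and at lists containing a non-cover are irrelevant. *)
definition rothberger_strategy_Two ::
    "'a topology \<Rightarrow> ('a set set list \<Rightarrow> 'a set) \<Rightarrow> bool" where
  "rothberger_strategy_Two X \<sigma> \<longleftrightarrow>
     (\<forall>\<U>s. \<U>s \<noteq> [] \<and> (\<forall>\<U>\<in>set \<U>s. open_cover X \<U>) \<longrightarrow> \<sigma> \<U>s \<in> last \<U>s)"

definition rothberger_winning_strategy_Two ::
    "'a topology \<Rightarrow> ('a set set list \<Rightarrow> 'a set) \<Rightarrow> bool" where
  "rothberger_winning_strategy_Two X \<sigma> \<longleftrightarrow>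
     rothberger_strategy_Two X \<sigma> \<and>
     (\<forall>\<U> :: nat \<Rightarrow> 'a set set. (\<forall>n. open_cover X (\<U> n)) \<longrightarrow>
        topspace X = (\<Union>n. \<sigma> (map \<U> [0..<Suc n])))"

definition G_delta_topology :: "'a topology \<Rightarrow> 'a topology" where
  "G_delta_topology X = topology_generated_by {S. gdelta_in X S}"

end

theory Submission
  imports Defs
begin

text \<open>
  The argument turns a winning strategy \<open>\<sigma>\<close> of Two into a countable set of points of \<open>X\<close>.
  After any finite sequence \<open>c\<close> of covers, some point \<open>x\<close> is such that Two can be made to answer
  with any prescribed open neighbourhood of \<open>x\<close>: otherwise every point would have a neighbourhood
  that Two never plays next, and these neighbourhoods would form a cover to which she has no answer
  (\<open>strategy_point\<close>).

  Given a cover of \<open>X\<^sub>\<delta>\<close>, every point \<open>x\<close> lies in a \<open>G\<^sub>\<delta>\<close> set \<open>\<Inter>n. U x n\<close> inside a member of the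
  cover (\<open>G_delta_topology_neighbourhood\<close>). Take the point \<open>x\<close> belonging to a position \<open>c\<close> and, for
  each \<open>n\<close>, a move of One that Two answers with \<open>U x n\<close>. Starting from the empty position, this
  yields a countably branching tree of positions, hence countably many points. The members of the
  cover chosen for these points already cover: a point \<open>y\<close> missed by all of them would, at each
  position, lie outside some \<open>U x n\<close>, and following these choices of \<open>n\<close> through the tree would give
  a play against \<open>\<sigma>\<close> in which Two never covers \<open>y\<close>.
\<close>

text \<open>Intersecting two sequences of open sets termwise intersects their intersections, so the
  \<open>G\<^sub>\<delta>\<close> sets are a base, and not merely a subbase, of the topology that they generate.\<close>

lemma G_delta_topology_neighbourhood:
  assumes "openin (G_delta_topology X) V" and "y \<in> V"
  shows "\<exists>U :: nat \<Rightarrow> 'a set. (\<forall>n. openin X (U n)) \<and> y \<in> (\<Inter>n. U n) \<and> (\<Inter>n. U n) \<subseteq> V"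
proof -
  have "generate_topology_on {S. gdelta_in X S} V"
    using assms(1) by (simp add: G_delta_topology_def openin_topology_generated_by_iff)
  then show ?thesis
    using assms(2)
  proof (induction arbitrary: y)
    case Empty
    then show ?case by simp
  next
    case (Int A B)
    obtain U where U: "\<forall>n. openin X (U n)" "y \<in> (\<Inter>n. U n)" "(\<Inter>n::nat. U n) \<subseteq> A"
      using Int.IH(1)[of y] Int.prems by blast
    obtain W where W: "\<forall>n. openin X (W n)" "y \<in> (\<Inter>n. W n)" "(\<Inter>n::nat. W n) \<subseteq> B"
      using Int.IH(2)[of y] Int.prems by blast
    show ?case
      by (rule exI[of _ "\<lambda>n. U n \<inter> W n"]) (use U W in auto)
  next
    case (UN K)
    then obtain k where k: "k \<in> K" "y \<in> k"
      by blast
    obtain U where "\<forall>n. openin X (U n)" "y \<in> (\<Inter>n. U n)" "(\<Inter>n::nat. U n) \<subseteq> k"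
      using UN.IH[OF k] by blast
    with k(1) show ?case
      by (intro exI[of _ U]) blast
  next
    case (Basis S)
    then obtain C :: "nat \<Rightarrow> 'a set" where "\<forall>n. openin X (C n)" "\<Inter>(range C) = S"
      unfolding gdelta_in_descending by blast
    with Basis.prems show ?case
      by (intro exI[of _ C]) auto
  qed
qed

lemma topspace_G_delta_topology [simp]: "topspace (G_delta_topology X) = topspace X"
proof -
  have "gdelta_in X (topspace X)"
    by (simp add: open_imp_gdelta_in)
  then show ?thesis
    unfolding G_delta_topology_def topology_generated_by_topspace
    using gdelta_in_subset by fastforce
qed

text \<open>If every point had a neighbourhood that Two never answers with, then One could play the cover
  consisting of these neighbourhoods, and whatever Two chooses from it is one of them. For an empty
  space the cover in question is empty, and a strategy cannot exist.\<close>

lemma strategy_point: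
  assumes "rothberger_strategy_Two X \<sigma>" and c: "\<forall>\<U>\<in>set c. open_cover X \<U>"
  shows "\<exists>x\<in>topspace X. \<forall>U. openin X U \<and> x \<in> U \<longrightarrow>
           (\<exists>\<W>. open_cover X \<W> \<and> \<sigma> (c @ [\<W>]) = U)"
proof (rule ccontr)
  assume "\<not> ?thesis"
  then have "\<exists>U. openin X U \<and> x \<in> U \<and> (\<forall>\<W>. open_cover X \<W> \<longrightarrow> \<sigma> (c @ [\<W>]) \<noteq> U)"
    if "x \<in> topspace X" for x
    using that by simp
  then obtain f where f: "\<And>x. x \<in> topspace X \<Longrightarrow> openin X (f x) \<and> x \<in> f x \<and>
      (\<forall>\<W>. open_cover X \<W> \<longrightarrow> \<sigma> (c @ [\<W>]) \<noteq> f x)"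
    by metis
  have cover: "open_cover X (f ` topspace X)"
    unfolding open_cover_def using f openin_subset by fastforce
  have "\<sigma> (c @ [f ` topspace X]) \<in> last (c @ [f ` topspace X])"
    using assms(1)[unfolded rothberger_strategy_Two_def, rule_format, of "c @ [f ` topspace X]"]
      c cover by auto
  then have "\<sigma> (c @ [f ` topspace X]) \<in> f ` topspace X"
    by simp
  with f cover show False
    by blast
qed

text \<open>The position reached when, at each position \<open>c\<close>, One uses the move \<open>W c n\<close> with the next
  number \<open>n\<close> of the list. Labelling by lists of numbers makes the tree of positions countable.\<close>

definition tree_position :: "('b list \<Rightarrow> nat \<Rightarrow> 'b) \<Rightarrow> nat list \<Rightarrow> 'b list" where
  "tree_position W = foldl (\<lambda>c n. c @ [W c n]) []"

lemma tree_position_Nil: "tree_position W [] = []"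
  by (simp add: tree_position_def)

lemma tree_position_snoc:
  "tree_position W (ns @ [n]) = tree_position W ns @ [W (tree_position W ns) n]"
  by (simp add: tree_position_def)

lemma tree_position_set:
  assumes "\<And>c n. \<forall>b\<in>set c. P b \<Longrightarrow> P (W c n)"
  shows "\<forall>b\<in>set (tree_position W ns). P b"
  by (induction ns rule: rev_induct)
    (use assms in \<open>auto simp: tree_position_Nil tree_position_snoc\<close>)

text \<open>A choice \<open>N\<close> of a successor at every position traces an infinite branch of the tree.\<close>

lemma tree_position_branch:
  fixes W :: "'b list \<Rightarrow> nat \<Rightarrow> 'b" and N :: "'b list \<Rightarrow> nat"
  obtains B :: "nat \<Rightarrow> 'b"
  where "\<And>k. map B [0..<k] \<in> range (tree_position W)"
    and "\<And>k. B k = W (map B [0..<k]) (N (map B [0..<k]))"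
proof -
  define c where "c = rec_nat [] (\<lambda>_ p. p @ [W p (N p)])"
  define B where "B = (\<lambda>k. W (c k) (N (c k)))"
  have c_map: "c k = map B [0..<k]" for k
    by (induction k) (auto simp: c_def B_def)
  have "c k \<in> range (tree_position W)" for k
  proof (induction k)
    case 0
    show ?case
      by (metis c_def old.nat.simps(6) rangeI tree_position_Nil)
  next
    case (Suc k)
    then obtain ns where "c k = tree_position W ns"
      by blast
    then have "c (Suc k) = tree_position W (ns @ [N (c k)])"
      by (simp add: c_def tree_position_snoc)
    then show ?case
      by simp
  qed
  then show thesis
    by (intro that[of B]) (simp_all only: c_map[symmetric], simp add: B_def)
qed

theorem proposition2p15:
  fixes X :: "'a topology"
  assumes "\<exists>\<sigma>. rothberger_winning_strategy_Two X \<sigma>"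
  shows "Lindelof_space (G_delta_topology X)"
  unfolding Lindelof_space_def topspace_G_delta_topology
proof (intro allI impI, elim conjE)
  fix \<V>
  assume \<V>_open: "\<forall>V\<in>\<V>. openin (G_delta_topology X) V" and \<V>_cover: "\<Union>\<V> = topspace X"
  obtain \<sigma> where strategy: "rothberger_strategy_Two X \<sigma>"
    and wins: "\<And>\<U>. (\<forall>n::nat. open_cover X (\<U> n)) \<Longrightarrow>
          topspace X = (\<Union>n. \<sigma> (map \<U> [0..<Suc n]))"
    using assms unfolding rothberger_winning_strategy_Two_def by blast
  have "\<exists>V U. V \<in> \<V> \<and> (\<forall>n::nat. openin X (U n) \<and> x \<in> U n) \<and> (\<Inter>n. U n) \<subseteq> V"
    if x: "x \<in> topspace X" for x
  proof -
    obtain V where V: "V \<in> \<V>" "x \<in> V"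
      using x \<V>_cover by blast
    then obtain U :: "nat \<Rightarrow> 'a set"
      where "\<forall>n. openin X (U n)" "x \<in> (\<Inter>n. U n)" "(\<Inter>n. U n) \<subseteq> V"
      using G_delta_topology_neighbourhood[of X V x] \<V>_open by metis
    with V(1) show ?thesis
      by (intro exI[of _ V] exI[of _ U]) simp
  qed
  then obtain V U where VU: "\<And>x. x \<in> topspace X \<Longrightarrow>
      V x \<in> \<V> \<and> (\<forall>n::nat. openin X (U x n) \<and> x \<in> U x n) \<and> (\<Inter>n. U x n) \<subseteq> V x"
    by metis
  obtain x where x: "\<And>c. \<forall>\<U>\<in>set c. open_cover X \<U> \<Longrightarrow> x c \<in> topspace X"
    and x_forced: "\<And>c G. \<forall>\<U>\<in>set c. open_cover X \<U> \<Longrightarrow> openin X G \<Longrightarrow> x c \<in> G \<Longrightarrow>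
        \<exists>\<W>. open_cover X \<W> \<and> \<sigma> (c @ [\<W>]) = G"
    using strategy_point[OF strategy] by metis
  have "\<exists>\<W>. (\<forall>\<U>\<in>set c. open_cover X \<U>) \<longrightarrow> open_cover X \<W> \<and> \<sigma> (c @ [\<W>]) = U (x c) n" for c n
    using x[of c] x_forced[of c "U (x c) n"] VU[of "x c"] by blast
  then obtain W where W_cover: "\<And>c n. \<forall>\<U>\<in>set c. open_cover X \<U> \<Longrightarrow> open_cover X (W c n)"
    and W_answer: "\<And>c n. \<forall>\<U>\<in>set c. open_cover X \<U> \<Longrightarrow> \<sigma> (c @ [W c n]) = U (x c) n"
    by metis
  let ?T = "range (tree_position W)"
  have legal: "\<forall>\<U>\<in>set c. open_cover X \<U>" if "c \<in> ?T" for c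
    using that tree_position_set[of "open_cover X" W] W_cover by blast
  have "y \<in> (\<Union>c\<in>?T. V (x c))" if y: "y \<in> topspace X" for y
  proof (rule ccontr)
    assume missed: "y \<notin> (\<Union>c\<in>?T. V (x c))"
    have "\<exists>n. y \<notin> U (x c) n" if "c \<in> ?T" for c
      using missed that VU[OF x[OF legal[OF that]]] by blast
    then obtain N where N: "\<And>c. c \<in> ?T \<Longrightarrow> y \<notin> U (x c) (N c)"
      by metis
    obtain B where B_tree: "\<And>k. map B [0..<k] \<in> ?T"
      and B_step: "\<And>k. B k = W (map B [0..<k]) (N (map B [0..<k]))"
      using tree_position_branch[of W N] by blast
    have "open_cover X (B k)" for k
      using W_cover[OF legal[OF B_tree]] B_step by metis
    moreover have "y \<notin> \<sigma> (map B [0..<Suc k])" for k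
    proof -
      have "map B [0..<Suc k] = map B [0..<k] @ [W (map B [0..<k]) (N (map B [0..<k]))]"
        using B_step[of k] by simp
      then show ?thesis
        using W_answer[OF legal[OF B_tree]] N[OF B_tree] by metis
    qed
    ultimately show False
      using wins[of B] y by blast
  qed
  then have "topspace X \<subseteq> \<Union>(V ` x ` ?T)"
    by auto
  moreover have sub: "V ` x ` ?T \<subseteq> \<V>"
    using VU x legal by blast
  then have "\<Union>(V ` x ` ?T) \<subseteq> topspace X"
    using \<V>_cover by (metis Union_mono)
  ultimately have "\<Union>(V ` x ` ?T) = topspace X"
    by (rule equalityI[rotated])
  moreover have "countable (V ` x ` ?T)"
    by simp
  ultimately show "\<exists>\<V>'. countable \<V>' \<and> \<V>' \<subseteq> \<V> \<and> \<Union>\<V>' = topspace X"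
    using sub by (intro exI[of _ "V ` x ` ?T"] conjI)
qed

end
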